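(* Assume Martin's Axiom. Let $X$ be a compactum such that $t(X)=\omega$ and $\pi w(X)<\mathfrak{c}$. Then $\pi Nt(X)=\omega$.
   Context: A compactum is a compact Hausdorff space; $t(X)$ is the tightness and $\pi w(X)$ the $\pi$-weight; $\mathfrak{c}=2^{\aleph_0}$. Families of open sets are ordered by inclusion; a family is $\kappa^{\mathrm{op}}$-like if no member is contained in $\kappa$-many members. $\pi Nt(X)$ is the least $\kappa\geq\omega$ such that $X$ has a $\kappa^{\mathrm{op}}$-like $\pi$-base. *)

theory Defs
  imports "HOL-Analysis.Analysis"
begin

definition partial_order_on' :: "'p set \<Rightarrow> ('p \<Rightarrow> 'p \<Rightarrow> bool) \<Rightarrow> bool" where
  "partial_order_on' P le \<longleftrightarrow>
     (\<forall>p\<in>P. le p p) \<and>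
     (\<forall>p\<in>P. \<forall>q\<in>P. \<forall>r\<in>P. le p q \<and> le q r \<longrightarrow> le p r) \<and>
     (\<forall>p\<in>P. \<forall>q\<in>P. le p q \<and> le q p \<longrightarrow> p = q)"

definition compatible_in :: "'p set \<Rightarrow> ('p \<Rightarrow> 'p \<Rightarrow> bool) \<Rightarrow> 'p \<Rightarrow> 'p \<Rightarrow> bool" where
  "compatible_in P le p q \<longleftrightarrow> (\<exists>r\<in>P. le r p \<and> le r q)"

definition antichain_in :: "'p set \<Rightarrow> ('p \<Rightarrow> 'p \<Rightarrow> bool) \<Rightarrow> 'p set \<Rightarrow> bool" where
  "antichain_in P le A \<longleftrightarrow> A \<subseteq> P \<and>
     (\<forall>p\<in>A. \<forall>q\<in>A. p \<noteq> q \<longrightarrow> \<not> compatible_in P le p q)"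

definition ccc_poset :: "'p set \<Rightarrow> ('p \<Rightarrow> 'p \<Rightarrow> bool) \<Rightarrow> bool" where
  "ccc_poset P le \<longleftrightarrow> (\<forall>A. antichain_in P le A \<longrightarrow> countable A)"

definition dense_in :: "'p set \<Rightarrow> ('p \<Rightarrow> 'p \<Rightarrow> bool) \<Rightarrow> 'p set \<Rightarrow> bool" where
  "dense_in P le D \<longleftrightarrow> D \<subseteq> P \<and> (\<forall>p\<in>P. \<exists>d\<in>D. le d p)"

definition filter_in :: "'p set \<Rightarrow> ('p \<Rightarrow> 'p \<Rightarrow> bool) \<Rightarrow> 'p set \<Rightarrow> bool" where
  "filter_in P le G \<longleftrightarrow> G \<subseteq> P \<and> G \<noteq> {} \<and>
     (\<forall>p\<in>G. \<forall>q\<in>P. le p q \<longrightarrow> q \<in> G) \<and>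
     (\<forall>p\<in>G. \<forall>q\<in>G. \<exists>r\<in>G. le r p \<and> le r q)"

text \<open>Martin's Axiom for posets whose underlying set lies in the type 'p.
  Instantiated with a type of size continuum (nat set), this is equivalent to full MA,
  since MA(kappa) only needs to be verified for ccc posets of size at most kappa < c.\<close>
definition MA_for :: "'p itself \<Rightarrow> bool" where
  "MA_for _ \<longleftrightarrow>
     (\<forall>(P::'p set) le (\<D>::'p set set).
        P \<noteq> {} \<and> partial_order_on' P le \<and> ccc_poset P le \<and>
        (\<forall>D\<in>\<D>. dense_in P le D) \<and>
        (card_of \<D>, card_of (UNIV :: real set)) \<in> ordLess
        \<longrightarrow> (\<exists>G. filter_in P le G \<and> (\<forall>D\<in>\<D>. G \<inter> D \<noteq> {})))"

abbreviation MartinsAxiom :: bool where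
  "MartinsAxiom \<equiv> MA_for TYPE(nat set)"

definition is_compactum :: "'a topology \<Rightarrow> bool" where
  "is_compactum X \<longleftrightarrow> compact_space X \<and> Hausdorff_space X"

definition countably_tight :: "'a topology \<Rightarrow> bool" where
  "countably_tight X \<longleftrightarrow>
     (\<forall>A x. A \<subseteq> topspace X \<and> x \<in> X closure_of A \<longrightarrow>
        (\<exists>B\<subseteq>A. countable B \<and> x \<in> X closure_of B))"

definition pi_base :: "'a topology \<Rightarrow> 'a set set \<Rightarrow> bool" where
  "pi_base X \<B> \<longleftrightarrow>
     (\<forall>B\<in>\<B>. openin X B \<and> B \<noteq> {}) \<and>
     (\<forall>U. openin X U \<and> U \<noteq> {} \<longrightarrow> (\<exists>B\<in>\<B>. B \<subseteq> U))"

definition pi_weight_less_c :: "'a topology \<Rightarrow> bool" where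
  "pi_weight_less_c X \<longleftrightarrow>
     (\<exists>\<B>. pi_base X \<B> \<and> (card_of \<B>, card_of (UNIV :: real set)) \<in> ordLess)"

definition omega_op_like :: "'a set set \<Rightarrow> bool" where
  "omega_op_like \<B> \<longleftrightarrow> (\<forall>U\<in>\<B>. finite {V\<in>\<B>. U \<subseteq> V})"

text \<open>piNt(X) = omega iff X has an omega^op-like pi-base (omega is the least admissible value).\<close>
definition piNt_eq_omega :: "'a topology \<Rightarrow> bool" where
  "piNt_eq_omega X \<longleftrightarrow> (\<exists>\<B>. pi_base X \<B> \<and> omega_op_like \<B>)"

end

theory Submission
  imports Defs "HOL-Library.Countable_Set_Type"
begin

text \<open>
  Locally, at an open set \<open>U\<close> all of whose nonempty open subsets have the same \<open>\<pi>\<close>-weight as \<open>U\<close>,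
  Shapirovskii's argument gives a \<open>\<pi>\<close>-base whose closures are point-countable: each new member is
  chosen so small that it contains none of the nonempty closed \<open>G\<^sub>\<delta>\<close> sets cut out by finitely many
  earlier choices, and then a point in uncountably many closures yields a free sequence of length
  \<open>\<omega>\<^sub>1\<close>, which countable tightness forbids. Such a \<open>\<pi>\<close>-base \<open>A\<close> of size below the continuum is thinned
  out by Martin's Axiom, applied to the finite subsets of \<open>A\<close>, where a stronger condition may add no
  superset of an old member. Point-countability makes this poset ccc: from an uncountable antichain
  a \<open>\<Delta>\<close>-system and the compactness of \<open>X\<^sup>n\<close> produce a point in uncountably many closures. Local
  families are glued along a maximal disjoint family of open sets.
\<close>

unbundle cardinal_syntax

section \<open>Combinatorics of finite sets and Martin's Axiom\<close>

text \<open>Finite subsets are stratified by size: each level is covered by an image of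
  \<open>A\<close> times the previous level, and there are countably many levels. The bound goes
  through an infinite \<open>B\<close> because \<open>A\<close> itself may be finite.\<close>

lemma card_of_Fpow_le:
  assumes inf: "infinite B" and AB: "|A| \<le>o |B|" shows "|Fpow A| \<le>o |B|"
proof -
  define F where "F n = {S. S \<subseteq> A \<and> finite S \<and> card S = n}" for n
  have F: "|F n| \<le>o |B|" for n
  proof (induction n)
    case 0
    have "F 0 \<subseteq> {{}}" by (auto simp: F_def)
    moreover have "|{{}} :: 'b set set| \<le>o |B|"
      using inf by (intro card_of_singl_ordLeq) auto
    ultimately show ?case using card_of_mono1 ordLeq_transitive by blast
  next
    case (Suc n)
    have "F (Suc n) \<subseteq> (\<lambda>(a, S). insert a S) ` (A \<times> F n)"
    proof
      fix S assume "S \<in> F (Suc n)"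
      then have S: "S \<subseteq> A" "finite S" "card S = Suc n" by (auto simp: F_def)
      then obtain a where a: "a \<in> S" by fastforce
      then have "S = insert a (S - {a})" "S - {a} \<in> F n" "a \<in> A" using S by (auto simp: F_def)
      then show "S \<in> (\<lambda>(a, S). insert a S) ` (A \<times> F n)" by (force intro: image_eqI[of _ _ "(a, S - {a})"])
    qed
    moreover have "|A \<times> F n| \<le>o |B|"
      using card_of_Sigma_ordLeq_infinite[OF inf AB, of "\<lambda>_. F n"] Suc by blast
    ultimately show ?case using surj_imp_ordLeq ordLeq_transitive by blast
  qed
  have "Fpow A = (\<Union>n. F n)" by (auto simp: F_def Fpow_def)
  moreover have "|\<Union>n. F n| \<le>o |B|"
    using F inf infinite_iff_card_of_nat by (intro card_of_UNION_ordLeq_infinite) auto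
  ultimately show ?thesis by simp
qed

text \<open>Zorn's lemma: a set disjoint from all of \<M> could be added. The empty set is excluded
  because it is disjoint from everything. This serves both the \<Delta>-system argument and the
  gluing of local families.\<close>

lemma maximal_disjoint_subfamily:
  obtains \<M> where "\<M> \<subseteq> \<C>" "pairwise disjnt \<M>" "\<And>U. U \<in> \<C> \<Longrightarrow> U \<noteq> {} \<Longrightarrow> \<exists>M\<in>\<M>. \<not> disjnt U M"
proof -
  let ?A = "{\<M>. \<M> \<subseteq> \<C> \<and> pairwise disjnt \<M>}"
  have "\<exists>M\<in>?A. \<forall>X\<in>?A. M \<subseteq> X \<longrightarrow> X = M"
  proof (rule subset_Zorn')
    fix C assume C: "subset.chain ?A C"
    then have "pairwise disjnt (\<Union>C)"
      by (intro pairwise_chain_Union) (auto simp only: subset.chain_def chain_subset_def, blast?)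
    then show "\<Union>C \<in> ?A" using C unfolding subset.chain_def by blast
  qed
  then obtain M where M: "M \<subseteq> \<C>" "pairwise disjnt M"
    and max: "\<And>X. X \<subseteq> \<C> \<Longrightarrow> pairwise disjnt X \<Longrightarrow> M \<subseteq> X \<Longrightarrow> X = M" by auto
  have "\<exists>N\<in>M. \<not> disjnt U N" if "U \<in> \<C>" "U \<noteq> {}" for U
  proof (rule ccontr)
    assume d: "\<not> ?thesis"
    then have "insert U M = M"
      using that M by (intro max) (auto simp: pairwise_insert disjnt_sym)
    with d that show False by (auto simp: disjnt_def)
  qed
  with M that show thesis by blast
qed

text \<open>Induction on the common size. Either some point lies in uncountably many members, and
  deleting it there lowers the size by one, or a maximal disjoint subfamily is already uncountable
  and has empty root.\<close>

lemma delta_system: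
  assumes "uncountable \<A>" "\<And>p. p \<in> \<A> \<Longrightarrow> finite p \<and> card p = n"
  obtains \<B> d where "\<B> \<subseteq> \<A>" "uncountable \<B>" "\<And>p. p \<in> \<B> \<Longrightarrow> d \<subseteq> p"
    "\<And>p q. p \<in> \<B> \<Longrightarrow> q \<in> \<B> \<Longrightarrow> p \<noteq> q \<Longrightarrow> p \<inter> q = d"
proof -
  have "\<exists>\<B> d. \<B> \<subseteq> \<A> \<and> uncountable \<B> \<and> (\<forall>p\<in>\<B>. d \<subseteq> p) \<and>
     (\<forall>p\<in>\<B>. \<forall>q\<in>\<B>. p \<noteq> q \<longrightarrow> p \<inter> q = d)"
    using assms
  proof (induction n arbitrary: \<A>)
    case 0
    then have "\<A> \<subseteq> {{}}" by fastforce
    then show ?case using 0 by (meson countable_empty countable_insert countable_subset)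
  next
    case (Suc n)
    show ?case
    proof (cases "\<exists>x. uncountable {p\<in>\<A>. x \<in> p}")
      case True
      then obtain x where x: "uncountable {p\<in>\<A>. x \<in> p}" by blast
      have inj: "inj_on (\<lambda>p. p - {x}) {p\<in>\<A>. x \<in> p}" by (rule inj_onI) blast
      have "uncountable ((\<lambda>p. p - {x}) ` {p\<in>\<A>. x \<in> p})"
        using x inj countable_image_inj_on by blast
      from Suc.IH[OF this] obtain \<B> d where B: "\<B> \<subseteq> (\<lambda>p. p - {x}) ` {p\<in>\<A>. x \<in> p}" "uncountable \<B>"
        "\<forall>p\<in>\<B>. d \<subseteq> p" "\<forall>p\<in>\<B>. \<forall>q\<in>\<B>. p \<noteq> q \<longrightarrow> p \<inter> q = d"
        using Suc.prems(2) by force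
      have inj2: "inj_on (insert x) \<B>" using B(1) by (intro inj_onI) blast
      then have "uncountable (insert x ` \<B>)" using B(2) countable_image_inj_on by blast
      moreover have "insert x ` \<B> \<subseteq> \<A>" using B(1) by (auto simp: insert_absorb)
      moreover have "\<forall>p\<in>insert x ` \<B>. \<forall>q\<in>insert x ` \<B>. p \<noteq> q \<longrightarrow> p \<inter> q = insert x d"
        using B(4) by auto
      ultimately show ?thesis using B(3) by (intro exI[of _ "insert x ` \<B>"] exI[of _ "insert x d"]) auto
    next
      case False
      obtain \<M> where M: "\<M> \<subseteq> \<A>" "pairwise disjnt \<M>" "\<And>p. p \<in> \<A> \<Longrightarrow> p \<noteq> {} \<Longrightarrow> \<exists>q\<in>\<M>. \<not> disjnt p q"
        using maximal_disjoint_subfamily by metis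
      \<comment> \<open>Otherwise the countable set \<open>\<Union>\<M>\<close> would meet every
        member of \<A>, while each of its points lies in only countably many members.\<close>
      have "uncountable \<M>"
      proof
        assume "countable \<M>"
        then have "countable (\<Union>\<M>)" using M(1) Suc.prems(2) by (intro countable_UN[of _ id, simplified]) (auto simp: countable_finite)
        then have "countable (\<Union>x\<in>\<Union>\<M>. {p\<in>\<A>. x \<in> p})" using False by blast
        moreover have "\<A> \<subseteq> (\<Union>x\<in>\<Union>\<M>. {p\<in>\<A>. x \<in> p})"
        proof
          fix p assume p: "p \<in> \<A>"
          then have "p \<noteq> {}" using Suc.prems(2) by fastforce
          with M(3) p show "p \<in> (\<Union>x\<in>\<Union>\<M>. {p\<in>\<A>. x \<in> p})" by (fastforce simp: disjnt_def)
        qed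
        ultimately show False using Suc.prems(1) countable_subset by blast
      qed
      moreover have "\<forall>p\<in>\<M>. \<forall>q\<in>\<M>. p \<noteq> q \<longrightarrow> p \<inter> q = {}"
        using M(2) by (auto simp: pairwise_def disjnt_def)
      ultimately show ?thesis using M(1) by blast
    qed
  qed
  with that show thesis by metis
qed

text \<open>\<open>MartinsAxiom\<close> speaks only of posets carried by the type
  \<open>nat set\<close>. That type has continuum many elements, so \<open>P\<close> is copied into
  it by an injection \<open>h\<close>, and the filter is brought back by \<open>g\<close>.\<close>

lemma MA_for_posets_up_to_continuum:
  assumes MA: MartinsAxiom and card: "|P| \<le>o |UNIV :: real set|"
    and P: "P \<noteq> {}" "partial_order_on' P le" "ccc_poset P le"
    and D: "\<And>D. D \<in> \<D> \<Longrightarrow> dense_in P le D" "|\<D>| <o |UNIV :: real set|"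
  obtains G where "filter_in P le G" "\<And>D. D \<in> \<D> \<Longrightarrow> G \<inter> D \<noteq> {}"
proof -
  have "(UNIV :: real set) \<lesssim> (UNIV :: nat set set)"
    using nat_sets_eqpoll_reals eqpoll_sym eqpoll_imp_lepoll by blast
  then have "|UNIV :: real set| \<le>o |UNIV :: nat set set|"
    unfolding lepoll_def card_of_ordLeq[symmetric] by auto
  then have "|P| \<le>o |UNIV :: nat set set|" using card ordLeq_transitive by blast
  then obtain h :: "_ \<Rightarrow> nat set" where h: "inj_on h P" unfolding card_of_ordLeq[symmetric] by blast
  define g where "g = inv_into P h"
  have g[simp]: "g (h p) = p" if "p \<in> P" for p using h that by (simp add: g_def)
  define le' where "le' x y = le (g x) (g y)" for x y
  have le'[simp]: "le' (h p) (h q) = le p q" if "p \<in> P" "q \<in> P" for p q using that by (simp add: le'_def)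
  have po: "partial_order_on' (h ` P) le'"
    unfolding partial_order_on'_def
  proof (intro conjI ballI impI)
    fix x assume "x \<in> h ` P"
    then show "le' x x" using P(2) unfolding partial_order_on'_def le'_def by fastforce
  next
    fix x y z assume "x \<in> h ` P" "y \<in> h ` P" "z \<in> h ` P" "le' x y \<and> le' y z"
    then obtain p q r where "p \<in> P" "q \<in> P" "r \<in> P" "x = h p" "y = h q" "z = h r" "le p q" "le q r" by auto
    moreover from this have "le p r" using P(2) unfolding partial_order_on'_def by blast
    ultimately show "le' x z" by simp
  next
    fix x y assume "x \<in> h ` P" "y \<in> h ` P" "le' x y \<and> le' y x"
    then obtain p q where "p \<in> P" "q \<in> P" "x = h p" "y = h q" "le p q" "le q p" by auto
    moreover from this have "p = q" using P(2) unfolding partial_order_on'_def by blast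
    ultimately show "x = y" by simp
  qed
  have ccc: "ccc_poset (h ` P) le'" unfolding ccc_poset_def
  proof (intro allI impI)
    fix A assume A: "antichain_in (h ` P) le' A"
    then obtain B where B: "B \<subseteq> P" "A = h ` B" unfolding antichain_in_def subset_image_iff by blast
    have "antichain_in P le B" unfolding antichain_in_def
    proof (intro conjI ballI impI)
      fix p q assume pq: "p \<in> B" "q \<in> B" "p \<noteq> q"
      then have "h p \<noteq> h q" using B h by (meson inj_on_def subsetD)
      then have "\<not> compatible_in (h ` P) le' (h p) (h q)" using A pq B by (auto simp: antichain_in_def)
      then show "\<not> compatible_in P le p q" using pq B by (auto simp: compatible_in_def subset_iff)
    qed (use B in auto)
    then show "countable A" using P(3) B by (auto simp: ccc_poset_def)
  qed
  have dense: "\<forall>D\<in>(`) h ` \<D>. dense_in (h ` P) le' D"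
  proof
    fix E assume "E \<in> (`) h ` \<D>"
    then obtain D where E: "E = h ` D" "D \<in> \<D>" by blast
    then have "dense_in P le D" using D by blast
    then show "dense_in (h ` P) le' E" using E by (fastforce simp: dense_in_def subset_iff)
  qed
  have "|(`) h ` \<D>| <o |UNIV :: real set|" using D(2) card_of_image ordLeq_ordLess_trans by blast
  with MA[unfolded MA_for_def, rule_format, of "h ` P" le' "(`) h ` \<D>"] po ccc dense P(1)
  obtain G where G: "filter_in (h ` P) le' G" "\<forall>D\<in>(`) h ` \<D>. G \<inter> D \<noteq> {}" by auto
  let ?G = "g ` G"
  have GP: "G \<subseteq> h ` P" using G by (simp add: filter_in_def)
  have "filter_in P le ?G" unfolding filter_in_def
  proof (intro conjI ballI impI)
    show "?G \<subseteq> P" using GP by auto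
    show "?G \<noteq> {}" using G by (simp add: filter_in_def)
  next
    fix p q assume p: "p \<in> ?G" and q: "q \<in> P" and le: "le p q"
    from p obtain x where x: "x \<in> G" "p = g x" by blast
    then have "le' x (h q)" using le q by (simp add: le'_def)
    then have "h q \<in> G" using G(1) x q by (auto simp: filter_in_def)
    then show "q \<in> ?G" using q g by (metis image_eqI)
  next
    fix p q assume "p \<in> ?G" "q \<in> ?G"
    then obtain x y where "x \<in> G" "y \<in> G" "p = g x" "q = g y" by blast
    with G(1) show "\<exists>r\<in>?G. le r p \<and> le r q" unfolding filter_in_def le'_def by blast
  qed
  moreover have "?G \<inter> D \<noteq> {}" if "D \<in> \<D>" for D
  proof -
    have "G \<inter> h ` D \<noteq> {}" using G that by blast
    then obtain d where "d \<in> D" "h d \<in> G" by blast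
    moreover have "d \<in> P" using D(1)[OF that] calculation by (auto simp: dense_in_def)
    ultimately show ?thesis by (metis disjoint_iff g image_eqI)
  qed
  ultimately show thesis using that by blast
qed

section \<open>Thinning out a point-countable \<open>\<pi>\<close>-base\<close>

text \<open>The left argument is the stronger condition. Once \<open>q\<close> belongs to a filter,
  every superset of a member of \<open>q\<close> that occurs in some condition of the filter already
  lies in \<open>q\<close>.\<close>

definition end_extends :: "'a set set \<Rightarrow> 'a set set \<Rightarrow> bool" where
  "end_extends p q \<longleftrightarrow> q \<subseteq> p \<and> (\<forall>a\<in>p - q. \<forall>b\<in>q. \<not> b \<subseteq> a)"

lemma partial_order_end_extends: "partial_order_on' P end_extends"
  unfolding partial_order_on'_def
proof (intro conjI ballI impI)
  fix p q r :: "'a set set" assume "end_extends p q \<and> end_extends q r"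
  then show "end_extends p r" unfolding end_extends_def by (metis Diff_iff subset_iff)
qed (auto simp: end_extends_def)

text \<open>Two conditions fail to have their union as a common extension only if a set of one
  contains a set of the other. Point-countability orients this relation: for finitely many
  conditions, some further one has, for each of them, a set included in one of theirs. One tuple of
  points then serves them all, and compactness does the rest.\<close>

lemma ccc_end_extends:
  assumes X: "compact_space X"
    and A: "\<And>a. a \<in> A \<Longrightarrow> a \<noteq> {} \<and> a \<subseteq> topspace X"
    and pc: "\<And>x. countable {a\<in>A. x \<in> X closure_of a}"
  shows "ccc_poset (Fpow A) end_extends"
  unfolding ccc_poset_def
proof (intro allI impI, rule ccontr)
  fix \<A> assume anti: "antichain_in (Fpow A) end_extends \<A>" and unc: "uncountable \<A>"
  have fin: "finite p" "p \<subseteq> A" if "p \<in> \<A>" for p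
    using anti that by (auto simp: antichain_in_def Fpow_def)
  have "\<exists>n. uncountable {p\<in>\<A>. card p = n}"
  proof (rule ccontr)
    assume "\<not> ?thesis"
    then have "countable (\<Union>n. {p\<in>\<A>. card p = n})" by (intro countable_UN) auto
    moreover have "(\<Union>n. {p\<in>\<A>. card p = n}) = \<A>" by auto
    ultimately show False using unc by simp
  qed
  then obtain n where n: "uncountable {p\<in>\<A>. card p = n}" by blast
  obtain \<B> d where B: "\<B> \<subseteq> {p\<in>\<A>. card p = n}" "uncountable \<B>" "\<And>p. p \<in> \<B> \<Longrightarrow> d \<subseteq> p"
    and root: "\<And>p q. p \<in> \<B> \<Longrightarrow> q \<in> \<B> \<Longrightarrow> p \<noteq> q \<Longrightarrow> p \<inter> q = d"
    by (rule delta_system[OF n, of n]) (use fin in auto)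
  have BA: "p \<in> \<A>" "card p = n" "finite p" "p \<subseteq> A" if "p \<in> \<B>" for p using B(1) that fin by blast+
  define up where "up b = {a\<in>A. b \<subseteq> a}" for b
  \<comment> \<open>All supersets of \<open>b\<close> share any given point of \<open>b\<close>, so
    point-countability bounds their number.\<close>
  have up: "countable (up b)" if b: "b \<in> A" for b
  proof -
    obtain x where x: "x \<in> b" using A b by blast
    have "up b \<subseteq> {a\<in>A. x \<in> X closure_of a}"
      using x A closure_of_subset[of _ X] unfolding up_def by (auto dest!: subsetD)
    then show ?thesis using pc countable_subset by blast
  qed
  \<comment> \<open>The sets \<open>p - d\<close> are pairwise disjoint, so each element of
    \<open>Z\<close> lies in at most one of them.\<close>
  have hit: "countable {p\<in>\<B>. (p - d) \<inter> Z \<noteq> {}}" if "countable Z" for Z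
  proof -
    have "countable {p\<in>\<B>. z \<in> p - d}" for z
    proof (cases "{p\<in>\<B>. z \<in> p - d} = {}")
      case False
      then obtain p where p: "p \<in> \<B>" "z \<in> p - d" by blast
      then have "{p\<in>\<B>. z \<in> p - d} \<subseteq> {p}" using root by blast
      then show ?thesis by (meson countable_empty countable_insert countable_subset)
    qed (metis countable_empty)
    then have "countable (\<Union>z\<in>Z. {p\<in>\<B>. z \<in> p - d})" using that by blast
    then show ?thesis by (rule countable_subset[rotated]) auto
  qed
  define U where "U = (\<Union>b\<in>d. up b)"
  have "\<B> \<noteq> {}" using B(2) by auto
  then have "finite d" "d \<subseteq> A" using B(3) BA by (meson all_not_in_conv finite_subset order_trans)+
  then have U: "countable U" using up unfolding U_def by (intro countable_UN) (auto simp: countable_finite)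
  \<comment> \<open>Only countably many conditions have a superset of a root member in their new
    part. Without them, an inclusion that blocks compatibility must run between parts outside
    \<open>d\<close>.\<close>
  define \<E> where "\<E> = {p\<in>\<B>. (p - d) \<inter> U = {}}"
  have EB: "p \<in> \<B>" if "p \<in> \<E>" for p using that by (simp add: \<E>_def)
  have "\<B> = \<E> \<union> {p\<in>\<B>. (p - d) \<inter> U \<noteq> {}}" by (auto simp: \<E>_def)
  then have E: "uncountable \<E>" using countable_Un[OF _ hit[OF U], of \<E>] B(2) by argo
  define R where "R p q \<longleftrightarrow> (\<exists>a\<in>p - d. \<exists>b\<in>q - d. b \<subseteq> a)" for p q
  have step: "end_extends (p \<union> q) p" if "p \<in> \<E>" "q \<in> \<E>" "\<not> R q p" for p q
    unfolding end_extends_def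
  proof (intro conjI ballI notI)
    fix a b assume a: "a \<in> p \<union> q - p" and b: "b \<in> p" and ba: "b \<subseteq> a"
    have a': "a \<in> q - d" "a \<in> A" using a B(3) EB that BA by blast+
    have "b \<notin> d" using a' ba that(2) by (auto simp: \<E>_def U_def up_def)
    then show False using that(3) a' b ba by (auto simp: R_def)
  qed auto
  \<comment> \<open>Otherwise \<open>p \<union> q\<close> would extend both \<open>p\<close> and
    \<open>q\<close>.\<close>
  have R: "R p q \<or> R q p" if "p \<in> \<E>" "q \<in> \<E>" "p \<noteq> q" for p q
  proof (rule ccontr)
    assume "\<not> ?thesis"
    then have "end_extends (p \<union> q) p" "end_extends (p \<union> q) q" using step[of p q] step[of q p] that by (auto simp: Un_commute)
    moreover have "p \<union> q \<in> Fpow A" using BA EB that by (simp add: Fpow_def)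
    ultimately have "compatible_in (Fpow A) end_extends p q" by (auto simp: compatible_in_def)
    then show False using anti that BA EB by (auto simp: antichain_in_def)
  qed
  have Rc: "countable {p\<in>\<E>. R p q}" if q: "q \<in> \<E>" for q
  proof -
    have "countable (\<Union>b\<in>q. up b)" using BA[of q] EB[OF q] up by (intro countable_UN) (auto simp: countable_finite)
    from hit[OF this] show ?thesis
    proof (rule countable_subset[rotated], intro subsetI)
      fix p assume p: "p \<in> {p \<in> \<E>. R p q}"
      then obtain a b where ab: "a \<in> p - d" "b \<in> q" "b \<subseteq> a" by (auto simp: R_def)
      then have "a \<in> up b" using p EB BA(4) by (auto simp: up_def)
      then show "p \<in> {p \<in> \<B>. (p - d) \<inter> \<Union> (up ` q) \<noteq> {}}" using ab p EB by blast
    qed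
  qed
  \<comment> \<open>Choose \<open>q\<close> outside \<open>T\<close> and outside the countably many
    conditions with \<open>R q p\<close> for some \<open>p\<close> in \<open>T\<close>; then
    \<open>R\<close> can only hold in the wanted direction.\<close>
  have ex: "\<exists>q\<in>\<E>. \<forall>p\<in>T. R p q" if T: "finite T" "T \<subseteq> \<E>" for T
  proof -
    have "countable (T \<union> (\<Union>p\<in>T. {q\<in>\<E>. R q p}))" using T Rc by (auto simp: countable_finite subset_iff)
    then have "\<not> \<E> \<subseteq> T \<union> (\<Union>p\<in>T. {q\<in>\<E>. R q p})" using E countable_subset by blast
    then obtain q where q: "q \<in> \<E>" "q \<notin> T" "\<And>p. p \<in> T \<Longrightarrow> \<not> R q p" by blast
    then have "R p q" if "p \<in> T" for p using R[of p q] that T(2) by blast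
    then show ?thesis using q by blast
  qed
  \<comment> \<open>For \<open>q\<close> as in \<open>ex\<close>, a tuple with one point from each
    of the \<open>n\<close> members of \<open>q\<close> lies in \<open>C p\<close> for every
    \<open>p\<close> in \<open>T\<close>. This gives the finite intersection property in the
    \<open>n\<close>-th power of \<open>X\<close>.\<close>
  define Y where "Y = product_topology (\<lambda>_. X) {..<n}"
  have Y: "compact_space Y" using X by (simp add: Y_def compact_space_product_topology)
  define C where "C p = {y \<in> topspace Y. \<exists>j<n. \<exists>a\<in>p - d. y j \<in> X closure_of a}" for p
  have C: "closedin Y (C p)" if p: "p \<in> \<E>" for p
  proof -
    have "C p = (\<Union>(j, a)\<in>{..<n} \<times> (p - d). {y \<in> topspace Y. y j \<in> X closure_of a})"
      by (auto simp: C_def)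
    moreover have "closedin Y {y \<in> topspace Y. y j \<in> X closure_of a}" if "j < n" for j a
      using that unfolding Y_def
      by (intro closedin_continuous_map_preimage[where Y = X] continuous_map_product_projection) auto
    ultimately show ?thesis using BA EB p by (auto intro!: closedin_Union)
  qed
  have fip: "\<Inter>(C ` T) \<noteq> {}" if T: "finite T" "T \<subseteq> \<E>" for T
  proof -
    obtain q where q: "q \<in> \<E>" "\<And>p. p \<in> T \<Longrightarrow> R p q" using ex[OF T] by blast
    obtain e where e: "bij_betw e {0..<n} q" using ex_bij_betw_nat_finite[of q] BA(2,3)[OF EB[OF q(1)]] by auto
    define y where "y = (\<lambda>j\<in>{..<n}. SOME x. x \<in> e j)"
    have eA: "e j \<in> A" if "j < n" for j using e that BA(4)[OF EB[OF q(1)]] by (auto simp: bij_betw_def)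
    have y: "y j \<in> e j" if "j < n" for j using that A[OF eA[OF that]] some_in_eq[of "e j"] by (simp add: y_def)
    have yY: "y \<in> topspace Y" using y A[OF eA] by (fastforce simp: Y_def y_def)
    have "y \<in> C p" if p: "p \<in> T" for p
    proof -
      obtain a b where ab: "a \<in> p - d" "b \<in> q - d" "b \<subseteq> a" using q(2)[OF p] by (auto simp: R_def)
      then obtain j where j: "j < n" "b = e j" using e by (auto simp: bij_betw_def)
      have "a \<in> A" using ab p T BA(4)[of p] EB by blast
      then have "y j \<in> X closure_of a" using A[of a] closure_of_subset[of a X] y[OF j(1)] j ab by blast
      then show ?thesis using j ab yY by (auto simp: C_def)
    qed
    then show ?thesis by blast
  qed
  have "\<Inter>(C ` \<E>) \<noteq> {}"
    proof (rule Y[unfolded compact_space_fip, rule_format], intro conjI ballI allI impI)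
    fix \<F> assume "finite \<F> \<and> \<F> \<subseteq> C ` \<E>"
    then obtain T where "T \<subseteq> \<E>" "finite T" "\<F> = C ` T" by (meson finite_subset_image)
    then show "\<Inter>\<F> \<noteq> {}" using fip by blast
  qed (use C in blast)
  then obtain y where y: "\<And>p. p \<in> \<E> \<Longrightarrow> y \<in> C p" by blast
  \<comment> \<open>Every \<open>p - d\<close> contains a set whose closure has a coordinate of
    \<open>y\<close>. There are countably many such sets, so by \<open>hit\<close> only countably
    many \<open>p\<close> are left.\<close>
  have "countable (\<Union>j<n. {a\<in>A. y j \<in> X closure_of a})" using pc by (intro countable_UN) auto
  from hit[OF this] have "countable \<E>"
  proof (rule countable_subset[rotated], intro subsetI)
    fix p assume p: "p \<in> \<E>"
    then obtain j a where ja: "j < n" "a \<in> p - d" "y j \<in> X closure_of a" using y[OF p] by (auto simp: C_def)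
    then have "a \<in> A" using BA(4) EB p by blast
    then show "p \<in> {p \<in> \<B>. (p - d) \<inter> (\<Union>j<n. {a \<in> A. y j \<in> X closure_of a}) \<noteq> {}}" using ja EB p by blast
  qed
  with E show False ..
qed

text \<open>Hypothesis \<open>ext\<close> is exactly the density of \<open>D a\<close>: the set
  \<open>b\<close> below \<open>a\<close> contains no member of the condition, so it may be added.
  The union of a filter meeting every \<open>D a\<close> is the wanted family.\<close>

lemma MA_omega_op_like_refinement:
  assumes MA: MartinsAxiom and X: "compact_space X"
    and A: "\<And>a. a \<in> A \<Longrightarrow> a \<noteq> {} \<and> a \<subseteq> topspace X"
    and pc: "\<And>x. countable {a\<in>A. x \<in> X closure_of a}"
    and card: "|A| <o |UNIV :: real set|"
    and ext: "\<And>a q. a \<in> A \<Longrightarrow> finite q \<Longrightarrow> q \<subseteq> A \<Longrightarrow> \<exists>b\<in>A. b \<subseteq> a \<and> (\<forall>c\<in>q. \<not> c \<subseteq> b)"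
  shows "\<exists>\<B>\<subseteq>A. omega_op_like \<B> \<and> (\<forall>a\<in>A. \<exists>b\<in>\<B>. b \<subseteq> a)"
proof -
  define D where "D a = {p \<in> Fpow A. \<exists>b\<in>p. b \<subseteq> a}" for a
  have "|Fpow A| \<le>o |UNIV :: real set|"
    using card by (intro card_of_Fpow_le ordLess_imp_ordLeq) (auto simp: infinite_UNIV_char_0)
  moreover have "dense_in (Fpow A) end_extends E" if E: "E \<in> D ` A" for E
    unfolding dense_in_def
  proof (intro conjI ballI)
    show "E \<subseteq> Fpow A" using E by (auto simp: D_def)
    fix q assume q: "q \<in> Fpow A"
    obtain a where a: "a \<in> A" "E = D a" using E by blast
    obtain b where b: "b \<in> A" "b \<subseteq> a" "\<forall>c\<in>q. \<not> c \<subseteq> b" using ext[of a q] a q by (auto simp: Fpow_def)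
    then have "insert b q \<in> E" "end_extends (insert b q) q" using a q by (auto simp: D_def Fpow_def end_extends_def)
    then show "\<exists>d\<in>E. end_extends d q" by blast
  qed
  moreover have "|D ` A| <o |UNIV :: real set|" using card card_of_image ordLeq_ordLess_trans by blast
  ultimately obtain G where G: "filter_in (Fpow A) end_extends G" "\<And>E. E \<in> D ` A \<Longrightarrow> G \<inter> E \<noteq> {}"
    using MA_for_posets_up_to_continuum[OF MA _ Fpow_not_empty partial_order_end_extends ccc_end_extends[OF X A pc], of "D ` A"]
    by blast
  show ?thesis
  proof (intro exI[of _ "\<Union>G"] conjI ballI)
    show "\<Union>G \<subseteq> A" using G(1) by (auto simp: filter_in_def Fpow_def)
    show "\<exists>b\<in>\<Union>G. b \<subseteq> a" if "a \<in> A" for a using G(2)[of "D a"] that by (auto simp: D_def)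
    show "omega_op_like (\<Union>G)" unfolding omega_op_like_def
    proof
      fix u assume "u \<in> \<Union>G"
      then obtain q where q: "q \<in> G" "u \<in> q" by blast
      \<comment> \<open>A common extension of \<open>p\<close> and \<open>q\<close> contains
        \<open>v\<close>; were \<open>v\<close> not in \<open>q\<close>, it would be a forbidden new
        superset of \<open>u\<close>.\<close>
      have "{v \<in> \<Union>G. u \<subseteq> v} \<subseteq> q"
      proof
        fix v assume "v \<in> {v \<in> \<Union>G. u \<subseteq> v}"
        then obtain p where p: "p \<in> G" "v \<in> p" "u \<subseteq> v" by blast
        then obtain r where "end_extends r p" "end_extends r q" using G(1) q unfolding filter_in_def by blast
        then show "v \<in> q" using p q unfolding end_extends_def by blast
      qed
      moreover have "finite q" using q G(1) by (auto simp: filter_in_def Fpow_def)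
      ultimately show "finite {v \<in> \<Union>G. u \<subseteq> v}" by (rule finite_subset)
    qed
  qed
qed

section \<open>Local \<pi>-bases and their gluing\<close>

text \<open>For open \<open>U\<close> this is a \<pi>-base of the subspace \<open>U\<close>, with
  its members taken as open sets of \<open>X\<close>.\<close>

definition local_pi_base :: "'a topology \<Rightarrow> 'a set \<Rightarrow> 'a set set \<Rightarrow> bool" where
  "local_pi_base X U \<B> \<longleftrightarrow>
     (\<forall>B\<in>\<B>. openin X B \<and> B \<noteq> {} \<and> B \<subseteq> U) \<and>
     (\<forall>W. openin X W \<and> W \<noteq> {} \<and> W \<subseteq> U \<longrightarrow> (\<exists>B\<in>\<B>. B \<subseteq> W))"

text \<open>Without isolated points the members of \<open>A\<close> are infinite. Removing from
  \<open>a\<close> one point of each member of a finite \<open>q\<close> leaves a nonempty open set,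
  and no member of \<open>q\<close> fits inside it. This is the extension property that the density
  argument requires.\<close>

lemma omega_op_like_local_pi_base:
  assumes MA: MartinsAxiom and X: "compact_space X" "Hausdorff_space X"
    and crowded: "\<And>x. x \<in> U \<Longrightarrow> \<not> openin X {x}"
    and A: "local_pi_base X U A"
    and pc: "\<And>x. countable {a\<in>A. x \<in> X closure_of a}"
    and card: "|A| <o |UNIV :: real set|"
  shows "\<exists>\<B>. local_pi_base X U \<B> \<and> omega_op_like \<B>"
proof -
  have Aop: "openin X a" "a \<noteq> {}" "a \<subseteq> topspace X" "a \<subseteq> U" if "a \<in> A" for a
    using A that openin_subset by (auto simp: local_pi_base_def)
  have A': "a \<noteq> {} \<and> a \<subseteq> topspace X" if "a \<in> A" for a using Aop(2,3)[OF that] ..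
  have pi: "\<exists>a\<in>A. a \<subseteq> W" if "openin X W" "W \<noteq> {}" "W \<subseteq> U" for W
    using A that by (simp add: local_pi_base_def)
  have cl: "closedin X S" if "finite S" "S \<subseteq> topspace X" for S
    using X(2) that by (simp add: closedin_Hausdorff_finite)
  have ext: "\<exists>b\<in>A. b \<subseteq> a \<and> (\<forall>c\<in>q. \<not> c \<subseteq> b)" if a: "a \<in> A" and q: "finite q" "q \<subseteq> A" for a q
  proof -
    have inf: "infinite a"
    proof
      assume f: "finite a"
      obtain x where x: "x \<in> a" using Aop a by blast
      \<comment> \<open>Finite sets are closed, so removing all other points of a finite open set
        isolates \<open>x\<close>.\<close>
      have "openin X (a - (a - {x}))" using Aop[OF a] f by (intro openin_diff cl) auto
      moreover have "a - (a - {x}) = {x}" using x by blast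
      ultimately show False using crowded Aop(4)[OF a] x by auto
    qed
    define S where "S = (\<lambda>c. SOME x. x \<in> c) ` q"
    have s: "(SOME x. x \<in> c) \<in> c" if "c \<in> q" for c using that q Aop some_in_eq by blast
    have S: "finite S" "S \<subseteq> topspace X" using q s Aop(3) unfolding S_def by blast+
    then have "openin X (a - S)" using Aop[OF a] cl by (intro openin_diff) auto
    moreover have "a - S \<noteq> {}" using inf S(1) by (metis Diff_eq_empty_iff finite_subset)
    moreover have "a - S \<subseteq> U" using Aop a by blast
    ultimately obtain b where b: "b \<in> A" "b \<subseteq> a - S" using A unfolding local_pi_base_def by blast
    have "\<not> c \<subseteq> b" if "c \<in> q" for c using s[OF that] b that by (auto simp: S_def)
    then show ?thesis using b by blast
  qed
  have "\<exists>\<B>\<subseteq>A. omega_op_like \<B> \<and> (\<forall>a\<in>A. \<exists>b\<in>\<B>. b \<subseteq> a)"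
    by (rule MA_omega_op_like_refinement[OF MA X(1) A' pc card ext])
  then obtain \<B> where B: "\<B> \<subseteq> A" "omega_op_like \<B>" "\<forall>a\<in>A. \<exists>b\<in>\<B>. b \<subseteq> a" by blast
  have "\<exists>B\<in>\<B>. B \<subseteq> W" if W: "openin X W" "W \<noteq> {}" "W \<subseteq> U" for W
  proof -
    obtain a where "a \<in> A" "a \<subseteq> W" using pi[OF W] by blast
    then show ?thesis using B(3) by (meson order_trans)
  qed
  moreover have "openin X B \<and> B \<noteq> {} \<and> B \<subseteq> U" if "B \<in> \<B>" for B
    using Aop(1,2,4)[of B] B(1) that by blast
  ultimately have "local_pi_base X U \<B>" by (simp add: local_pi_base_def)
  then show ?thesis using B(2) by blast
qed

text \<open>The local families over a maximal disjoint family of good open sets are united. Every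
  nonempty open set contains a good one, so maximality gives a \<pi>-base; disjointness keeps all
  supersets of a member within its own local family.\<close>

lemma pi_base_from_local:
  assumes loc: "\<And>U. openin X U \<Longrightarrow> U \<noteq> {} \<Longrightarrow>
    \<exists>V \<B>. openin X V \<and> V \<noteq> {} \<and> V \<subseteq> U \<and> local_pi_base X V \<B> \<and> omega_op_like \<B>"
  shows "piNt_eq_omega X"
proof -
  define \<C> where "\<C> = {V. openin X V \<and> V \<noteq> {} \<and> (\<exists>\<B>. local_pi_base X V \<B> \<and> omega_op_like \<B>)}"
  obtain \<M> where M: "\<M> \<subseteq> \<C>" "pairwise disjnt \<M>" "\<And>U. U \<in> \<C> \<Longrightarrow> U \<noteq> {} \<Longrightarrow> \<exists>V\<in>\<M>. \<not> disjnt U V"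
    using maximal_disjoint_subfamily by metis
  have "\<forall>V\<in>\<M>. \<exists>\<B>. local_pi_base X V \<B> \<and> omega_op_like \<B>" using M(1) by (auto simp: \<C>_def)
  then obtain \<beta> where \<beta>: "\<And>V. V \<in> \<M> \<Longrightarrow> local_pi_base X V (\<beta> V)" "\<And>V. V \<in> \<M> \<Longrightarrow> omega_op_like (\<beta> V)" by metis
  have "pi_base X (\<Union>V\<in>\<M>. \<beta> V)" unfolding pi_base_def
  proof (intro conjI ballI allI impI)
    fix W assume W: "openin X W \<and> W \<noteq> {}"
    then obtain U where U: "U \<in> \<C>" "U \<subseteq> W" "U \<noteq> {}" using loc[of W] by (auto simp: \<C>_def)
    then obtain V where V: "V \<in> \<M>" "U \<inter> V \<noteq> {}" using M(3)[OF U(1,3)] by (auto simp: disjnt_def)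
    have "openin X (W \<inter> V)" using W V M(1) by (auto simp: \<C>_def)
    moreover have "W \<inter> V \<noteq> {}" "W \<inter> V \<subseteq> V" using V U by auto
    ultimately obtain B where "B \<in> \<beta> V" "B \<subseteq> W \<inter> V" using \<beta>(1)[OF V(1)] unfolding local_pi_base_def by blast
    then show "\<exists>B\<in>\<Union>V\<in>\<M>. \<beta> V. B \<subseteq> W" using V by blast
  qed (use \<beta>(1) in \<open>auto simp: local_pi_base_def\<close>)
  moreover have "omega_op_like (\<Union>V\<in>\<M>. \<beta> V)" unfolding omega_op_like_def
  proof
    fix u assume "u \<in> (\<Union>V\<in>\<M>. \<beta> V)"
    then obtain V where V: "V \<in> \<M>" "u \<in> \<beta> V" by blast
    have sub: "w \<noteq> {} \<and> w \<subseteq> V'" if "w \<in> \<beta> V'" "V' \<in> \<M>" for w V'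
      using \<beta>(1)[OF that(2)] that(1) by (auto simp: local_pi_base_def)
    have "V' = V" if "V' \<in> \<M>" "v \<in> \<beta> V'" "u \<subseteq> v" for v V'
    proof -
      have "\<not> disjnt V' V" using sub[OF V(2,1)] sub[OF that(2,1)] that(3) by (auto simp: disjnt_def)
      then show ?thesis using M(2) V(1) that(1) unfolding pairwise_def by blast
    qed
    then have "{v \<in> \<Union>V\<in>\<M>. \<beta> V. u \<subseteq> v} \<subseteq> {v \<in> \<beta> V. u \<subseteq> v}" by blast
    then show "finite {v \<in> \<Union>V\<in>\<M>. \<beta> V. u \<subseteq> v}"
      using \<beta>(2)[OF V(1)] V(2) finite_subset unfolding omega_op_like_def by blast
  qed
  ultimately show ?thesis unfolding piNt_eq_omega_def by blast
qed

section \<open>Point-countable \<open>\<pi>\<close>-bases from countable tightness\<close>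

text \<open>For finite \<open>S\<close> and continuous functions these are the closed
  \<open>G\<^sub>\<delta>\<close> sets of the argument; an empty \<open>S\<close> gives the whole
  space.\<close>

definition nonpos_set :: "'a topology \<Rightarrow> ('s \<Rightarrow> 'a \<Rightarrow> real) \<Rightarrow> 's set \<Rightarrow> 'a set" where
  "nonpos_set X h S = {x \<in> topspace X. \<forall>s\<in>S. h s x \<le> 0}"

lemma closedin_le: "continuous_map X euclideanreal f \<Longrightarrow> closedin X {x \<in> topspace X. f x \<le> c}"
  using closedin_continuous_map_preimage[of X euclideanreal f "{..c}"] by simp

lemma closedin_ge: "continuous_map X euclideanreal f \<Longrightarrow> closedin X {x \<in> topspace X. c \<le> f x}"
  using closedin_continuous_map_preimage[of X euclideanreal f "{c..}"] by simp

lemma openin_less: "continuous_map X euclideanreal f \<Longrightarrow> openin X {x \<in> topspace X. f x < c}"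
  using openin_continuous_map_preimage[of X euclideanreal f "{..<c}"] by simp

lemma nonpos_set_nonempty:
  assumes X: "compact_space X" and h: "\<And>s. s \<in> S \<Longrightarrow> continuous_map X euclideanreal (h s)"
    and fin: "\<And>T. finite T \<Longrightarrow> T \<subseteq> S \<Longrightarrow> nonpos_set X h T \<noteq> {}"
  shows "nonpos_set X h S \<noteq> {}"
\<comment> \<open>An intersection over no indices is the whole type rather than
  \<open>topspace X\<close>, hence the separate case.\<close>
proof (cases "S = {}")
  case True
  then show ?thesis using fin[of "{}"] by simp
next
  case False
  define C where "C s = {x \<in> topspace X. h s x \<le> 0}" for s
  have "\<Inter>(C ` S) \<noteq> {}"
  proof (rule X[unfolded compact_space_fip, rule_format], intro conjI ballI allI impI)
    fix c assume "c \<in> C ` S" then show "closedin X c" using h closedin_le by (auto simp: C_def)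
  next
    fix \<F> assume "finite \<F> \<and> \<F> \<subseteq> C ` S"
    then obtain T where T: "T \<subseteq> S" "finite T" "\<F> = C ` T" by (meson finite_subset_image)
    then show "\<Inter>\<F> \<noteq> {}" using fin[of T] by (auto simp: nonpos_set_def C_def)
  qed
  then show ?thesis using False by (auto simp: nonpos_set_def C_def)
qed

text \<open>The sets \<open>E n\<close> are closed and decreasing, and a point common to all of them
  would lie in \<open>nonpos_set X h S\<close> but outside \<open>W\<close>. The explicit countable
  outer base obtained this way is what later allows neighbourhoods to be counted.\<close>

lemma nonpos_set_outer_base:
  assumes X: "compact_space X" and h: "\<And>s. s \<in> S \<Longrightarrow> continuous_map X euclideanreal (h s)"
    and W: "openin X W" "nonpos_set X h S \<subseteq> W"
  shows "\<exists>n. {x \<in> topspace X. \<forall>s\<in>S. h s x < 1 / real (Suc n)} \<subseteq> W"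
proof -
  \<comment> \<open>The weak inequality makes \<open>E n\<close> closed; the strict one of the
    conclusion implies it.\<close>
  define E where "E n = {x \<in> topspace X. \<forall>s\<in>S. h s x \<le> 1 / real (Suc n)} - W" for n
  have "E n = (topspace X \<inter> \<Inter>((\<lambda>s. {x \<in> topspace X. h s x \<le> 1 / real (Suc n)}) ` S)) - W" for n
    by (auto simp: E_def)
  moreover have "closedin X (topspace X \<inter> \<Inter>((\<lambda>s. {x \<in> topspace X. h s x \<le> 1 / real (Suc n)}) ` S))" for n
    using closedin_le[OF h] by (cases "S = {}") (auto intro!: closedin_Int closedin_Inter)
  ultimately have cl: "closedin X (E n)" for n using W(1) by (simp only: closedin_diff)
  have dec: "decseq E"
  proof (rule decseq_SucI)
    fix n
    have "1 / real (Suc (Suc n)) \<le> 1 / real (Suc n)" by (simp add: field_simps)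
    then show "E (Suc n) \<subseteq> E n" unfolding E_def by (smt (verit) Collect_mono Diff_mono order_refl)
  qed
  have "\<exists>n. E n = {}"
  proof (rule ccontr)
    assume "\<not> ?thesis"
    then obtain y where y: "\<And>n. y \<in> E n" using compact_space_imp_nest[OF X cl _ dec] by blast
    have "h s y \<le> 0" if "s \<in> S" for s
    proof (rule field_le_epsilon)
      fix e :: real assume "e > 0"
      then obtain n where "1 / real (Suc n) < e" using nat_approx_posE by blast
      then show "h s y \<le> 0 + e" using y[of n] that by (force simp: E_def)
    qed
    then have "y \<in> nonpos_set X h S" using y by (auto simp: nonpos_set_def E_def)
    then show False using W y by (auto simp: E_def)
  qed
  then obtain n where "E n = {}" by blast
  then show ?thesis by (intro exI[of _ n]) (force simp: E_def intro: less_imp_le)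
qed

text \<open>The index \<open>(b, True)\<close> imposes \<open>f b \<le> 0\<close> and \<open>(b, False)\<close> imposes \<open>f b \<ge> 1\<close> on \<open>nonpos_set\<close>.\<close>

definition signed :: "('b \<Rightarrow> 'a \<Rightarrow> real) \<Rightarrow> 'b \<times> bool \<Rightarrow> 'a \<Rightarrow> real" where
  "signed f s x = (if snd s then f (fst s) x else 1 - f (fst s) x)"

lemma continuous_signed:
  "continuous_map X euclideanreal (f (fst s)) \<Longrightarrow> continuous_map X euclideanreal (signed f s)"
  unfolding signed_def[abs_def] by (cases "snd s") (auto intro!: continuous_intros)

lemma nonpos_set_signed:
  "x \<in> nonpos_set X (signed f) (L \<times> {True} \<union> G \<times> {False}) \<longleftrightarrow>
    x \<in> topspace X \<and> (\<forall>b\<in>L. f b x \<le> 0) \<and> (\<forall>b\<in>G. 1 \<le> f b x)"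
  by (auto simp: nonpos_set_def signed_def ball_Un)

section \<open>Free sequences and countable tightness\<close>

lemma finite_max:
  assumes "finite G" "G \<noteq> {}" "G \<subseteq> T" "trans R" "total_on T R"
  obtains m where "m \<in> G" "\<And>a. a \<in> G \<Longrightarrow> a = m \<or> (a, m) \<in> R"
proof -
  have "\<exists>m\<in>G. \<forall>a\<in>G. a = m \<or> (a, m) \<in> R" using assms(1,2,3)
  proof (induction rule: finite_ne_induct)
    case (insert x F)
    then obtain m where m: "m \<in> F" "\<forall>a\<in>F. a = m \<or> (a, m) \<in> R" by auto
    then have "x = m \<or> (x, m) \<in> R \<or> (m, x) \<in> R" using insert assms(5) by (auto simp: total_on_def)
    then show ?case using m assms(4) by (auto dest: transD)
  qed simp
  then show thesis using that by blast
qed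

text \<open>For a well-order this extracts a subset of type \<open>\<omega>\<^sub>1\<close>: if some
  initial segment is uncountable, the segment below a minimal such point works.\<close>

lemma uncountable_short_segments:
  assumes "wf R" "uncountable T"
  shows "\<exists>T'\<subseteq>T. uncountable T' \<and> (\<forall>t\<in>T'. countable {c\<in>T'. (c, t) \<in> R})"
proof (cases "\<exists>t\<in>T. uncountable {c\<in>T. (c, t) \<in> R}")
  case False
  then show ?thesis using assms by blast
next
  case True
  define Q where "Q = {t\<in>T. uncountable {c\<in>T. (c, t) \<in> R}}"
  obtain t0 where "t0 \<in> Q" using True by (auto simp: Q_def)
  then obtain t where t: "t \<in> Q" and min: "\<And>c. (c, t) \<in> R \<Longrightarrow> c \<notin> Q"
    using wfE_min[OF assms(1)] by metis
  show ?thesis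
  proof (intro exI[of _ "{c\<in>T. (c, t) \<in> R}"] conjI ballI)
    fix c assume "c \<in> {c\<in>T. (c, t) \<in> R}"
    then have "countable {e\<in>T. (e, c) \<in> R}" using min[of c] by (simp add: Q_def)
    then show "countable {e \<in> {c\<in>T. (c, t) \<in> R}. (e, c) \<in> R}" by (rule countable_subset[rotated]) auto
  qed (use t in \<open>auto simp: Q_def\<close>)
qed

text \<open>\<open>T\<close> plays the role of \<open>\<omega>\<^sub>1\<close>. Points
  \<open>x \<gamma>\<close> are found at which the functions up to \<gamma> are at most 0 and the
  later ones at least 1, so \<open>f \<alpha>\<close> separates the points before \<alpha> from the
  tail that starts at \<alpha>. By tightness, a point in the closure of every tail is in the closure
  of countably many \<open>x \<gamma>\<close>, and an \<alpha> beyond these gives a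
  contradiction.\<close>

lemma no_long_free_sequence:
  assumes X: "compact_space X" and tight: "countably_tight X"
    and R: "trans R" "total_on T R"
    and T: "uncountable T" "\<And>t. t \<in> T \<Longrightarrow> countable {c\<in>T. (c, t) \<in> R}"
    and f: "\<And>t. t \<in> T \<Longrightarrow> continuous_map X euclideanreal (f t)"
    and p: "p \<in> topspace X" "\<And>t. t \<in> T \<Longrightarrow> f t p \<le> 0"
    and step: "\<And>t S. t \<in> T \<Longrightarrow> finite S \<Longrightarrow> S \<subseteq> {c\<in>T. (c, t) \<in> R} \<times> UNIV \<Longrightarrow>
      nonpos_set X (signed f) S \<noteq> {} \<Longrightarrow> \<exists>x\<in>nonpos_set X (signed f) S. 1 \<le> f t x"
  shows False
proof -
  define lo where "lo \<gamma> = {\<beta>\<in>T. \<beta> = \<gamma> \<or> (\<beta>, \<gamma>) \<in> R}" for \<gamma>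
  define hi where "hi \<gamma> = {\<alpha>\<in>T. (\<gamma>, \<alpha>) \<in> R}" for \<gamma>
  \<comment> \<open>Starting from \<open>p\<close>, the lower bounds are imposed in increasing
    order: \<open>step\<close> is applied to the largest \<open>m\<close> in \<open>G\<close>, when
    all other constraints have indices before \<open>m\<close>.\<close>
  have fin: "nonpos_set X (signed f) (L \<times> {True} \<union> G \<times> {False}) \<noteq> {}"
    if "finite G" "G \<subseteq> hi \<gamma>" "finite L" "L \<subseteq> lo \<gamma>" for \<gamma> L G
    using that(1,2)
  proof (induction rule: finite_psubset_induct)
    case (psubset G)
    show ?case
    proof (cases "G = {}")
      case True
      then have "p \<in> nonpos_set X (signed f) (L \<times> {True} \<union> G \<times> {False})"
        using p that(4) unfolding nonpos_set_signed by (auto simp: lo_def)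
      then show ?thesis by blast
    next
      case False
      obtain m where m: "m \<in> G" "\<And>a. a \<in> G \<Longrightarrow> a = m \<or> (a, m) \<in> R"
        using finite_max[OF psubset.hyps(1) False _ R(1,2)] psubset.prems by (auto simp: hi_def)
      let ?S = "L \<times> {True} \<union> (G - {m}) \<times> {False}"
      have mT: "m \<in> T" "(\<gamma>, m) \<in> R" using m(1) psubset.prems by (auto simp: hi_def)
      have "nonpos_set X (signed f) ?S \<noteq> {}" using psubset.IH[of "G - {m}"] m(1) psubset.prems by blast
      moreover have "finite ?S" using psubset.hyps(1) that(3) by simp
      moreover have "?S \<subseteq> {c\<in>T. (c, m) \<in> R} \<times> UNIV"
        using m(2) mT that(4) psubset.prems R(1) by (auto simp: lo_def hi_def dest: transD)
      ultimately obtain x where "x \<in> nonpos_set X (signed f) ?S" "1 \<le> f m x" using step[OF mT(1)] by blast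
      then have "x \<in> nonpos_set X (signed f) (L \<times> {True} \<union> G \<times> {False})"
        unfolding nonpos_set_signed by blast
      then show ?thesis by blast
    qed
  qed
  \<comment> \<open>Compactness passes from finitely many constraints to all of them.\<close>
  have "\<exists>x\<in>topspace X. (\<forall>\<beta>\<in>lo \<gamma>. f \<beta> x \<le> 0) \<and> (\<forall>\<alpha>\<in>hi \<gamma>. 1 \<le> f \<alpha> x)" for \<gamma>
  proof -
    let ?S = "lo \<gamma> \<times> {True} \<union> hi \<gamma> \<times> {False}"
    have "nonpos_set X (signed f) ?S \<noteq> {}"
    proof (rule nonpos_set_nonempty[OF X])
      fix s assume "s \<in> ?S"
      then show "continuous_map X euclideanreal (signed f s)"
        by (intro continuous_signed f) (auto simp: lo_def hi_def)
    next
      fix S assume S: "finite S" "S \<subseteq> ?S"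
      define L where "L = fst ` {s\<in>S. snd s}"
      define G where "G = fst ` {s\<in>S. \<not> snd s}"
      have "nonpos_set X (signed f) (L \<times> {True} \<union> G \<times> {False}) \<noteq> {}"
        using S by (intro fin[of _ \<gamma>]) (auto simp: L_def G_def)
      moreover have "S \<subseteq> L \<times> {True} \<union> G \<times> {False}" by (force simp: L_def G_def image_iff)
      then have "nonpos_set X (signed f) (L \<times> {True} \<union> G \<times> {False}) \<subseteq> nonpos_set X (signed f) S"
        by (auto simp: nonpos_set_def)
      ultimately show "nonpos_set X (signed f) S \<noteq> {}" by blast
    qed
    then obtain x where "x \<in> nonpos_set X (signed f) ?S" by blast
    then show ?thesis unfolding nonpos_set_signed by blast
  qed
  then obtain x where x: "\<And>\<gamma>. x \<gamma> \<in> topspace X" "\<And>\<gamma> \<beta>. \<beta> \<in> lo \<gamma> \<Longrightarrow> f \<beta> (x \<gamma>) \<le> 0"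
    "\<And>\<gamma> \<alpha>. \<alpha> \<in> hi \<gamma> \<Longrightarrow> 1 \<le> f \<alpha> (x \<gamma>)" by metis
  \<comment> \<open>These are the closures of the tails. For finitely many indices with largest
    element \<open>m\<close>, the point \<open>x m\<close> lies in all the corresponding
    tails.\<close>
  define E where "E \<alpha> = X closure_of (x ` {\<gamma>\<in>T. \<alpha> = \<gamma> \<or> (\<alpha>, \<gamma>) \<in> R})" for \<alpha>
  have "\<Inter>(E ` T) \<noteq> {}"
  proof (rule X[unfolded compact_space_fip, rule_format], intro conjI ballI allI impI)
    fix c assume "c \<in> E ` T" then show "closedin X c" by (auto simp: E_def)
  next
    fix \<F> assume "finite \<F> \<and> \<F> \<subseteq> E ` T"
    then obtain G where G: "G \<subseteq> T" "finite G" "\<F> = E ` G" by (meson finite_subset_image)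
    show "\<Inter>\<F> \<noteq> {}"
    proof (cases "G = {}")
      case False
      then obtain m where m: "m \<in> G" "\<And>a. a \<in> G \<Longrightarrow> a = m \<or> (a, m) \<in> R"
        using finite_max[OF G(2) False G(1) R(1,2)] by metis
      have "x m \<in> E a" if "a \<in> G" for a
      proof -
        have "x m \<in> x ` {\<gamma>\<in>T. a = \<gamma> \<or> (a, \<gamma>) \<in> R}" using m that G(1) by blast
        moreover have "x ` {\<gamma>\<in>T. a = \<gamma> \<or> (a, \<gamma>) \<in> R} \<subseteq> E a"
          unfolding E_def using x(1) by (intro closure_of_subset) auto
        ultimately show ?thesis by blast
      qed
      then show ?thesis using G(3) by blast
    qed (simp add: G(3))
  qed
  then obtain y where y: "\<And>\<alpha>. \<alpha> \<in> T \<Longrightarrow> y \<in> E \<alpha>" by blast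
  obtain t0 where "t0 \<in> T" using T(1) by fastforce
  then have "y \<in> X closure_of (x ` T)"
    using y[of t0] closure_of_mono[of "x ` {\<gamma>\<in>T. t0 = \<gamma> \<or> (t0, \<gamma>) \<in> R}" "x ` T" X] by (auto simp: E_def)
  moreover have "x ` T \<subseteq> topspace X" using x(1) by blast
  ultimately obtain B where B: "B \<subseteq> x ` T" "countable B" "y \<in> X closure_of B"
    using tight[unfolded countably_tight_def, rule_format, of "x ` T" y] by auto
  obtain C where C: "C \<subseteq> T" "countable C" "B = x ` C" using B(1,2) countable_subset_image[of B x T] by auto
  \<comment> \<open>Countable segments leave room for an \<alpha> beyond \<open>C\<close>. Then
    \<open>f \<alpha>\<close> is at least 1 on the closure of \<open>B\<close> and at most 0 on
    \<open>E \<alpha>\<close>, yet \<open>y\<close> lies in both.\<close>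
  have "countable (C \<union> (\<Union>c\<in>C. {e\<in>T. (e, c) \<in> R}))" using C T(2) by (intro countable_Un countable_UN) auto
  then have "\<not> T \<subseteq> C \<union> (\<Union>c\<in>C. {e\<in>T. (e, c) \<in> R})" using T(1) countable_subset by blast
  then obtain \<alpha> where \<alpha>: "\<alpha> \<in> T" "\<alpha> \<notin> C" "\<And>c. c \<in> C \<Longrightarrow> (\<alpha>, c) \<notin> R" by blast
  have "\<alpha> \<in> hi c" if c: "c \<in> C" for c
  proof -
    have "c \<in> T" "c \<noteq> \<alpha>" using c C(1) \<alpha>(2) by auto
    then have "(c, \<alpha>) \<in> R \<or> (\<alpha>, c) \<in> R" using R(2) \<alpha>(1) by (simp add: total_on_def)
    then show ?thesis using \<alpha>(1) \<alpha>(3)[OF c] by (simp add: hi_def)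
  qed
  then have "B \<subseteq> {z \<in> topspace X. 1 \<le> f \<alpha> z}" using C(3) x by auto
  then have "X closure_of B \<subseteq> {z \<in> topspace X. 1 \<le> f \<alpha> z}"
    by (intro closure_of_minimal closedin_ge f \<alpha>(1))
  moreover have "E \<alpha> \<subseteq> {z \<in> topspace X. f \<alpha> z \<le> 0}" unfolding E_def
  proof (intro closure_of_minimal closedin_le f \<alpha>(1))
    show "x ` {\<gamma>\<in>T. \<alpha> = \<gamma> \<or> (\<alpha>, \<gamma>) \<in> R} \<subseteq> {z \<in> topspace X. f \<alpha> z \<le> 0}"
      using x(1) x(2)[of \<alpha>] \<alpha>(1) by (auto simp: lo_def)
  qed
  ultimately show False using B(3) y[OF \<alpha>(1)] by force
qed

section \<open>Recursive choice of the members of a point-countable \<pi>-base\<close>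

text \<open>The neighbourhoods \<open>V S n\<close> number fewer than \<open>|B|\<close>, so those
  inside \<open>b\<close> form no local \<pi>-base of \<open>b\<close>, and some nonempty open
  \<open>W\<close> in \<open>b\<close> contains none of them. By
  \<open>nonpos_set_outer_base\<close>, \<open>W\<close> includes no nonempty set cut out by
  finitely many of the given functions. A Urysohn function for a point of \<open>W\<close> yields
  \<open>h\<close>.\<close>

lemma exists_separating_function:
  assumes X: "compact_space X" "Hausdorff_space X"
    and b: "openin X b" and B: "uncountable B" "|J| <o |B|"
    and min: "\<And>\<N>. local_pi_base X b \<N> \<Longrightarrow> |B| \<le>o |\<N>|"
    and f: "\<And>c. c \<in> J \<Longrightarrow> continuous_map X euclideanreal (f c)"
  shows "\<exists>h. continuous_map X euclideanreal h \<and> (\<exists>x\<in>topspace X. h x < 0) \<and>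
    {x \<in> topspace X. h x < 1} \<subseteq> b \<and>
    (\<forall>S. finite S \<longrightarrow> S \<subseteq> J \<times> UNIV \<longrightarrow> nonpos_set X (signed f) S \<noteq> {} \<longrightarrow>
      (\<exists>x\<in>nonpos_set X (signed f) S. 1 \<le> h x))"
proof -
  define I where "I = J \<times> (UNIV :: bool set)"
  define V where "V S n = {x \<in> topspace X. \<forall>s\<in>S. signed f s x < 1 / real (Suc n)}" for S n
  define \<N> where "\<N> = {V S n | S n. S \<in> Fpow I \<and> nonpos_set X (signed f) S \<noteq> {} \<and> V S n \<subseteq> b}"
  have cont: "continuous_map X euclideanreal (signed f s)" if "s \<in> S" "S \<subseteq> I" for s S
    using that f by (intro continuous_signed) (auto simp: I_def)
  \<comment> \<open>The summand \<open>nat\<close> makes \<open>Q\<close> infinite even if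
    \<open>J\<close> is finite; since \<open>B\<close> is uncountable, \<open>Q\<close> stays
    smaller than \<open>B\<close>.\<close>
  define Q where "Q = J <+> (UNIV :: nat set)"
  have Q: "infinite Q" by (auto simp: Q_def dest: finite_Plus_iff[THEN iffD1])
  have "|UNIV :: nat set| <o |B|"
    using B(1) by (simp add: countable_card_of_nat not_ordLeq_iff_ordLess card_of_Well_order)
  then have QB: "|Q| <o |B|"
    unfolding Q_def using B by (intro card_of_Plus_ordLess_infinite) (auto dest: countable_finite)
  have JQ: "|J| \<le>o |Q|" unfolding Q_def by (rule card_of_Plus1)
  have natQ: "|UNIV :: nat set| \<le>o |Q|" unfolding Q_def by (rule card_of_Plus2)
  have "|UNIV :: bool set| \<le>o |Q|"
    using countable_card_of_nat[of "UNIV :: bool set"] by (intro ordLeq_transitive[OF _ natQ]) simp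
  then have IQ: "|I| \<le>o |Q|" unfolding I_def by (intro card_of_Sigma_ordLeq_infinite[OF Q JQ]) blast
  have "|Fpow I| \<le>o |Q|" by (rule card_of_Fpow_le[OF Q IQ])
  then have "|Fpow I \<times> (UNIV :: nat set)| \<le>o |Q|"
    by (intro card_of_Sigma_ordLeq_infinite[OF Q]) (use natQ in blast)+
  moreover have "\<N> \<subseteq> (\<lambda>(S, n). V S n) ` (Fpow I \<times> (UNIV :: nat set))" by (auto simp: \<N>_def)
  then have "|\<N>| \<le>o |Fpow I \<times> (UNIV :: nat set)|" by (rule surj_imp_ordLeq)
  ultimately have "|\<N>| \<le>o |Q|" by (metis ordLeq_transitive)
  then have "|\<N>| <o |B|" using QB by (rule ordLeq_ordLess_trans)
  then have nb: "\<not> local_pi_base X b \<N>" using min[of \<N>] not_ordLess_ordLeq[of "|\<N>|" "|B|"] by auto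
  have Vop: "openin X (V S n)" if "S \<in> Fpow I" for S n
  proof -
    have "V S n = topspace X \<inter> \<Inter>((\<lambda>s. {x \<in> topspace X. signed f s x < 1 / real (Suc n)}) ` S)"
      by (auto simp: V_def)
    also have "openin X \<dots>"
    proof (cases "S = {}")
      case False
      have "openin X {x \<in> topspace X. signed f s x < 1 / real (Suc n)}" if "s \<in> S" for s
        using cont[OF that] \<open>S \<in> Fpow I\<close> by (intro openin_less) (simp add: Fpow_def)
      then show ?thesis using False that by (intro openin_Int openin_Inter) (auto simp: Fpow_def)
    qed simp
    finally show ?thesis .
  qed
  have Vne: "V S n \<noteq> {}" if S: "nonpos_set X (signed f) S \<noteq> {}" for S n
  proof -
    obtain x where x: "x \<in> nonpos_set X (signed f) S" using S by blast
    have "c < 1 / real (Suc n)" if "c \<le> 0" for c :: real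
      using that by (rule order.strict_trans1) simp
    then have "x \<in> V S n" using x by (simp add: nonpos_set_def V_def)
    then show ?thesis by blast
  qed
  have "\<forall>N\<in>\<N>. openin X N \<and> N \<noteq> {} \<and> N \<subseteq> b" using Vop Vne unfolding \<N>_def by blast
  then obtain W where W: "openin X W" "W \<noteq> {}" "W \<subseteq> b" "\<forall>N\<in>\<N>. \<not> N \<subseteq> W"
    using nb by (auto simp: local_pi_base_def)
  obtain x where x: "x \<in> W" "x \<in> topspace X" using openin_subset[OF W(1)] W(2) by blast
  have cr: "completely_regular_space X"
    using X by (simp add: compact_Hausdorff_imp_regular_space compact_imp_locally_compact_space
        locally_compact_regular_imp_completely_regular_space)
  have "closedin X (topspace X - W)" using W(1) by (simp add: closedin_diff)
  then obtain \<phi> :: "'a \<Rightarrow> real" where \<phi>: "continuous_map X (top_of_set {0..1}) \<phi>" "\<phi> x = 0" "\<phi> ` (topspace X - W) \<subseteq> {1}"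
    using cr[unfolded completely_regular_space_def, rule_format, of "topspace X - W" x] x by auto
  \<comment> \<open>The rescaling gives -1 at \<open>x\<close> and 1 off \<open>W\<close>. This
    leaves room for the level 0, where the closure of \<open>{h < 0}\<close> is controlled.\<close>
  define h where "h z = 2 * \<phi> z - 1" for z
  have "continuous_map X euclideanreal \<phi>" using \<phi>(1) by (simp add: continuous_map_in_subtopology)
  then have h: "continuous_map X euclideanreal h" unfolding h_def[abs_def] by (intro continuous_intros)
  have hW: "{z \<in> topspace X. h z < 1} \<subseteq> W" using \<phi>(3) by (fastforce simp: h_def)
  show ?thesis
  proof (intro exI[of _ h] conjI allI impI)
    show "continuous_map X euclideanreal h" by (rule h)
    show "\<exists>x\<in>topspace X. h x < 0" using x \<phi>(2) by (intro bexI[of _ x]) (auto simp: h_def)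
    show "{x \<in> topspace X. h x < 1} \<subseteq> b" using hW W(3) by blast
    fix S assume S: "finite S" "S \<subseteq> J \<times> UNIV" "nonpos_set X (signed f) S \<noteq> {}"
    then have SI: "S \<in> Fpow I" by (auto simp: Fpow_def I_def)
    show "\<exists>x\<in>nonpos_set X (signed f) S. 1 \<le> h x"
    proof (rule ccontr)
      assume "\<not> ?thesis"
      then have "\<forall>x\<in>nonpos_set X (signed f) S. h x < 1" by (simp add: not_le)
      then have "nonpos_set X (signed f) S \<subseteq> {x \<in> topspace X. h x < 1}"
        by (auto simp: nonpos_set_def)
      then have SW: "nonpos_set X (signed f) S \<subseteq> W" using hW by blast
      have "continuous_map X euclideanreal (signed f s)" if "s \<in> S" for s
        using cont[OF that] SI by (simp add: Fpow_def)
      then have "\<exists>n. V S n \<subseteq> W" unfolding V_def by (rule nonpos_set_outer_base[OF X(1) _ W(1) SW])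
      then obtain n where "V S n \<subseteq> W" by blast
      moreover from this have "V S n \<in> \<N>" using SI S(3) W(3) unfolding \<N>_def by blast
      ultimately show False using W(4) by blast
    qed
  qed
qed

text \<open>In the cardinal well-order of \<open>B\<close> fewer than \<open>|B|\<close> functions
  precede \<open>b\<close>, so \<open>min\<close> lets the recursion continue. The new members are
  the sets \<open>{f b < 0}\<close>, whose closures lie in \<open>{f b \<le> 0}\<close>; uncountably
  many of the latter with a common point would give the free sequence that tightness
  excludes.\<close>

lemma point_countable_pi_base:
  assumes X: "compact_space X" "Hausdorff_space X" and tight: "countably_tight X"
    and B: "local_pi_base X U B" "uncountable B"
    and min: "\<And>V \<N>. openin X V \<Longrightarrow> V \<noteq> {} \<Longrightarrow> V \<subseteq> U \<Longrightarrow> local_pi_base X V \<N> \<Longrightarrow> |B| \<le>o |\<N>|"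
  shows "\<exists>A. local_pi_base X U A \<and> |A| \<le>o |B| \<and> (\<forall>x. countable {a\<in>A. x \<in> X closure_of a})"
proof -
  define R where "R = |B| - Id"
  have wo: "well_order_on B |B|" by (rule card_of_well_order_on)
  have R: "wf R" "trans R" "total_on B R"
    using wo unfolding R_def well_order_on_def linear_order_on_def partial_order_on_def preorder_on_def
    by (auto simp: trans_diff_Id)
  have RB: "c \<in> B" if "(c, b) \<in> R" for b c
    using FieldI1[of c b "|B|"] that by (simp add: R_def Field_card_of)
  have seg: "|{c. (c, b) \<in> R}| <o |B|" if "b \<in> B" for b
  proof -
    have "{c. (c, b) \<in> R} = underS |B| b" by (auto simp: R_def underS_def)
    then show ?thesis using card_of_underS[OF card_of_Card_order, of b B] that by (simp add: Field_card_of)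
  qed
  have Bop: "openin X b" "b \<noteq> {}" "b \<subseteq> U" if "b \<in> B" for b using B(1) that by (auto simp: local_pi_base_def)
  \<comment> \<open>The condition depends on \<open>f\<close> only below \<open>b\<close>, as
    well-founded choice demands, and is vacuous outside \<open>B\<close> because the recursion runs
    over the whole type.\<close>
  define P where "P f b h \<longleftrightarrow> (b \<in> B \<longrightarrow> continuous_map X euclideanreal h \<and> (\<exists>x\<in>topspace X. h x < 0) \<and>
      {x \<in> topspace X. h x < 1} \<subseteq> b \<and>
      (\<forall>S. finite S \<longrightarrow> S \<subseteq> {c. (c, b) \<in> R} \<times> UNIV \<longrightarrow> nonpos_set X (signed f) S \<noteq> {} \<longrightarrow>
      (\<exists>x\<in>nonpos_set X (signed f) S. 1 \<le> h x)))" for f b h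
  have "\<exists>f. \<forall>b. P f b (f b)"
  proof (rule dependent_wf_choice[OF R(1)])
    fix f g :: "'a set \<Rightarrow> 'a \<Rightarrow> real" and b h assume eq: "\<And>c. (c, b) \<in> R \<Longrightarrow> f c = g c"
    have "nonpos_set X (signed f) S = nonpos_set X (signed g) S" if "S \<subseteq> {c. (c, b) \<in> R} \<times> UNIV" for S
    proof -
      have "signed f s = signed g s" if "s \<in> S" for s
      proof -
        have "(fst s, b) \<in> R" using that \<open>S \<subseteq> _\<close> by auto
        then show ?thesis using eq[of "fst s"] by (intro ext) (simp add: signed_def)
      qed
      then show ?thesis by (auto simp: nonpos_set_def)
    qed
    then show "P f b h = P g b h" unfolding P_def by (simp cong: imp_cong)
  next
    fix b and f :: "'a set \<Rightarrow> 'a \<Rightarrow> real" assume IH: "\<And>c. (c, b) \<in> R \<Longrightarrow> P f c (f c)"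
    show "\<exists>h. P f b h"
    proof (cases "b \<in> B")
      case True
      have cf: "continuous_map X euclideanreal (f c)" if "c \<in> {c. (c, b) \<in> R}" for c
        using IH[of c] RB[of c b] that by (simp add: P_def)
      have mb: "|B| \<le>o |\<N>|" if "local_pi_base X b \<N>" for \<N> using min[OF Bop[OF True] that] .
      show ?thesis
        using exists_separating_function[OF X Bop(1)[OF True] B(2) seg[OF True] mb cf] True
        unfolding P_def by simp
    qed (simp add: P_def)
  qed
  then obtain f where f: "\<And>b. P f b (f b)" by blast
  have cf: "continuous_map X euclideanreal (f b)" if "b \<in> B" for b using f[of b] that by (simp add: P_def)
  have neg: "\<exists>x\<in>topspace X. f b x < 0" if "b \<in> B" for b using f[of b] that by (simp add: P_def)
  have sub: "{x \<in> topspace X. f b x < 1} \<subseteq> b" if "b \<in> B" for b using f[of b] that by (simp add: P_def)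
  have avoid: "\<exists>x\<in>nonpos_set X (signed f) S. 1 \<le> f b x"
    if "b \<in> B" "finite S" "S \<subseteq> {c. (c, b) \<in> R} \<times> UNIV" "nonpos_set X (signed f) S \<noteq> {}" for b S
    using f[of b] that unfolding P_def by simp
  define a where "a b = {x \<in> topspace X. f b x < 0}" for b
  have ab: "openin X (a b)" "a b \<noteq> {}" "a b \<subseteq> b" if "b \<in> B" for b
    using openin_less[OF cf[OF that]] neg[OF that] sub[OF that] by (auto simp: a_def)
  have pc: "countable {b\<in>B. f b x \<le> 0}" if x: "x \<in> topspace X" for x
  proof (rule ccontr)
    assume "uncountable {b\<in>B. f b x \<le> 0}"
    \<comment> \<open>Passing to \<open>T\<close> keeps the avoidance property, since only
      constraints with earlier indices from \<open>T\<close> have to be considered.\<close>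
    from uncountable_short_segments[OF R(1) this]
    obtain T where T: "T \<subseteq> {b\<in>B. f b x \<le> 0}" "uncountable T" "\<forall>t\<in>T. countable {c\<in>T. (c, t) \<in> R}"
      by auto
    show False
    proof (rule no_long_free_sequence[OF X(1) tight R(2) _ T(2) T(3)[rule_format] _ x])
      show "total_on T R" using R(3) T(1) by (auto simp: total_on_def)
      show "continuous_map X euclideanreal (f t)" if "t \<in> T" for t using that T(1) cf by blast
      show "f t x \<le> 0" if "t \<in> T" for t using that T(1) by blast
      fix t S assume t: "t \<in> T" and S: "finite S" "S \<subseteq> {c\<in>T. (c, t) \<in> R} \<times> UNIV" "nonpos_set X (signed f) S \<noteq> {}"
      have "S \<subseteq> {c. (c, t) \<in> R} \<times> UNIV" using S(2) by auto
      then show "\<exists>x\<in>nonpos_set X (signed f) S. 1 \<le> f t x"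
        using avoid[of t S] t T(1) S(1,3) by blast
    qed
  qed
  show ?thesis
  proof (intro exI[of _ "a ` B"] conjI allI)
    have "\<exists>C\<in>a ` B. C \<subseteq> W" if W: "openin X W" "W \<noteq> {}" "W \<subseteq> U" for W
    proof -
      obtain b where "b \<in> B" "b \<subseteq> W" using B(1) W unfolding local_pi_base_def by blast
      then show ?thesis using ab(3) by blast
    qed
    moreover have "openin X C \<and> C \<noteq> {} \<and> C \<subseteq> U" if "C \<in> a ` B" for C
      using that ab Bop(3) by blast
    ultimately show "local_pi_base X U (a ` B)" by (simp add: local_pi_base_def)
    show "|a ` B| \<le>o |B|" by (rule card_of_image)
    fix x
    show "countable {C \<in> a ` B. x \<in> X closure_of C}"
    proof (cases "x \<in> topspace X")
      case True
      have "X closure_of (a b) \<subseteq> {x \<in> topspace X. f b x \<le> 0}" if "b \<in> B" for b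
        by (intro closure_of_minimal closedin_le cf that) (auto simp: a_def)
      then have "{C \<in> a ` B. x \<in> X closure_of C} \<subseteq> a ` {b\<in>B. f b x \<le> 0}" by blast
      then show ?thesis using pc[OF True] by (meson countable_image countable_subset)
    next
      case False
      then have "{C \<in> a ` B. x \<in> X closure_of C} = {}" using in_closure_of[of x X] by auto
      then show ?thesis by (simp only: countable_empty)
    qed
  qed
qed

section \<open>Reduction to open sets of minimal \<pi>-weight\<close>

theorem theorem2p30:
  fixes X :: "'a topology"
  assumes MA: MartinsAxiom
    and "is_compactum X"
    and "countably_tight X"
    and "pi_weight_less_c X"
  shows "piNt_eq_omega X"
proof (rule pi_base_from_local)
  have X: "compact_space X" "Hausdorff_space X" using assms(2) by (auto simp: is_compactum_def)
  obtain \<B>0 where B0: "pi_base X \<B>0" "|\<B>0| <o |UNIV :: real set|"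
    using assms(4) by (auto simp: pi_weight_less_c_def)
  fix U0 assume U0: "openin X U0" "U0 \<noteq> {}"
  show "\<exists>V \<B>. openin X V \<and> V \<noteq> {} \<and> V \<subseteq> U0 \<and> local_pi_base X V \<B> \<and> omega_op_like \<B>"
  \<comment> \<open>An isolated point gives an open singleton with a one-member family; otherwise
    \<open>U0\<close> has no isolated points.\<close>
  proof (cases "\<exists>x\<in>U0. openin X {x}")
    case True
    then obtain x where "x \<in> U0" "openin X {x}" by blast
    moreover from this have "local_pi_base X {x} {{x}}" by (auto simp: local_pi_base_def subset_singleton_iff)
    moreover have "omega_op_like {{x}}" by (simp add: omega_op_like_def)
    ultimately show ?thesis by (intro exI[of _ "{x}"] exI[of _ "{{x}}"]) auto
  next
    case False
    \<comment> \<open>A least cardinal in \<R> singles out an open \<open>U\<close> inside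
      \<open>U0\<close> none of whose nonempty open subsets has a local \<pi>-base smaller than
      \<open>B\<close>.\<close>
    define \<R> where "\<R> = {|\<B>| |V \<B>. openin X V \<and> V \<noteq> {} \<and> V \<subseteq> U0 \<and> local_pi_base X V \<B>}"
    have "local_pi_base X U0 {B\<in>\<B>0. B \<subseteq> U0}"
      unfolding local_pi_base_def
    proof (intro conjI ballI allI impI)
      fix W assume W: "openin X W \<and> W \<noteq> {} \<and> W \<subseteq> U0"
      then obtain B where "B \<in> \<B>0" "B \<subseteq> W" using B0(1) unfolding pi_base_def by meson
      then show "\<exists>B\<in>{B\<in>\<B>0. B \<subseteq> U0}. B \<subseteq> W" using W by blast
    qed (use B0(1) in \<open>auto simp: pi_base_def\<close>)
    then have in_R: "|{B\<in>\<B>0. B \<subseteq> U0}| \<in> \<R>" using U0 unfolding \<R>_def by blast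
    then have "\<R> \<noteq> {}" by blast
    moreover have "\<forall>r\<in>\<R>. Card_order r" by (auto simp: \<R>_def card_of_Card_order)
    ultimately obtain r where r: "r \<in> \<R>" "\<forall>r'\<in>\<R>. r \<le>o r'" using exists_minim_Card_order[of \<R>] by auto
    then obtain U B where U: "openin X U" "U \<noteq> {}" "U \<subseteq> U0" and B: "local_pi_base X U B" "r = |B|"
      unfolding \<R>_def by blast
    have min: "|B| \<le>o |\<N>|" if "openin X V" "V \<noteq> {}" "V \<subseteq> U" "local_pi_base X V \<N>" for V \<N>
    proof -
      have "|\<N>| \<in> \<R>" using that U(3) unfolding \<R>_def by blast
      then show ?thesis using r(2) B(2) by blast
    qed
    have "|B| \<le>o |{B\<in>\<B>0. B \<subseteq> U0}|" using r(2) in_R B(2) by blast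
    moreover have "|{B\<in>\<B>0. B \<subseteq> U0}| \<le>o |\<B>0|" by (rule card_of_mono1) auto
    ultimately have "|B| \<le>o |\<B>0|" by (rule ordLeq_transitive)
    then have Bc: "|B| <o |UNIV :: real set|" using B0(2) by (rule ordLeq_ordLess_trans)
    have "\<exists>A. local_pi_base X U A \<and> |A| \<le>o |B| \<and> (\<forall>x. countable {a\<in>A. x \<in> X closure_of a})"
    \<comment> \<open>A countable family is trivially point-countable. The recursive construction
      handles the uncountable case, where countably many neighbourhoods per finite constraint set do
      not affect the count.\<close>
    proof (cases "countable B")
      case True
      then have "countable {a\<in>B. x \<in> X closure_of a}" for x by (rule countable_subset[rotated]) auto
      moreover have "|B| \<le>o |B|" by (rule card_of_mono1) auto
      ultimately show ?thesis using B(1) by blast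
    next
      case False
      show ?thesis by (rule point_countable_pi_base[OF X assms(3) B(1) False min])
    qed
    then obtain A where A: "local_pi_base X U A" "|A| \<le>o |B|" "\<And>x. countable {a\<in>A. x \<in> X closure_of a}"
      by blast
    have Ac: "|A| <o |UNIV :: real set|" using A(2) Bc by (rule ordLeq_ordLess_trans)
    have crowded: "\<not> openin X {x}" if "x \<in> U" for x using False that U(3) by blast
    show ?thesis
      using omega_op_like_local_pi_base[OF MA X crowded A(1,3) Ac] U by blast
  qed
qed

end
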